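(* Let ${\bf A}$ be a Hermitian $2\times 2$ matrix with eigenvalues $d_1,d_2$, and let $m\ge1$ be an integer. If $d_1\neq d_2$, then $$\int_{M_2}\mathrm{Tr}\big(({\bf H}^*{\bf A}{\bf H})^m\big)\,d\nu({\bf H})=m!\left((m+1)\frac{d_1^{m+1}-d_2^{m+1}}{d_1-d_2}+\frac{d_1d_2^m-d_2d_1^m}{d_1-d_2}\right).$$ If $d_1=d_2=d$, then $$\int_{M_2}\mathrm{Tr}\big(({\bf H}^*{\bf A}{\bf H})^m\big)\,d\nu({\bf H})=m!\,(m^2+m+2)\,d^m.$$
   Context: $M_2$ denotes the set of $2\times 2$ complex matrices, $d{\bf H}$ Lebesgue measure on $M_2\cong\mathbb{R}^{8}$, and $d\nu({\bf H})=\pi^{-4}\exp(-\mathrm{Tr}({\bf H}^*{\bf H}))\,d{\bf H}$ the Gaussian probability measure. *)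

theory Defs
  imports "HOL-Analysis.Analysis"
begin

definition adjoint_mat :: "complex^'n^'n \<Rightarrow> complex^'n^'n" where
  "adjoint_mat H = (\<chi> i j. cnj (H $ j $ i))"

definition hermitian_mat :: "complex^'n^'n \<Rightarrow> bool" where
  "hermitian_mat A \<longleftrightarrow> adjoint_mat A = A"

(* matrix power w.r.t. matrix multiplication ** (note: ^ on vec is entrywise) *)
primrec matpow :: "'a::semiring_1^'n^'n \<Rightarrow> nat \<Rightarrow> 'a^'n^'n" where
  "matpow A 0 = mat 1"
| "matpow A (Suc k) = A ** matpow A k"

definition charpoly_at :: "complex^'n^'n \<Rightarrow> complex \<Rightarrow> complex" where
  "charpoly_at A x = det (mat x - A)"

(* the Gaussian probability measure on M_2 = complex^2^2 (identified with R^8, lborel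
   = Lebesgue measure there): density pi^-4 exp(-Tr(H^* H)) *)
definition gauss_M2 :: "(complex^2^2) measure" where
  "gauss_M2 = density lborel
     (\<lambda>H. ennreal (pi powr (-4) * exp (- Re (trace (adjoint_mat H ** H)))))"

end

theory Submission
  imports Defs "HOL-Probability.Distributions" "HOL-Computational_Algebra.Formal_Power_Series"
begin

text \<open>
  By Waring's formula the trace of the \<open>m\<close>-th power of \<open>W = H* A H\<close> is a polynomial in \<open>tr W\<close> and
  \<open>det W\<close>. The Gaussian measure is invariant under \<open>H \<mapsto> U H\<close> for \<open>U\<close> in SU(2), so \<open>A\<close> may be taken to be
  \<open>diag(d1, d2)\<close>; then \<open>tr W = d1 x + d2 y\<close> and \<open>det W = d1 d2 |det H|^2\<close>, where \<open>x\<close> and \<open>y\<close> are the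
  squared norms of the rows of \<open>H\<close>. Rotating the second row by a unitary depending on the first makes
  \<open>|det H|^2\<close> equal to \<open>x |h|^2\<close> with \<open>h\<close> an entry of the rotated row, which yields
  \<open>E[x^p y^s |det H|^(2j)] = p! s! j! (j+1)! C(p+j+1, j+1) C(s+j+1, j+1)\<close>. Collecting the coefficient of
  \<open>d1^k d2^(m-k)\<close> leaves an alternating sum over \<open>j\<close> that Vandermonde's identity evaluates to
  \<open>m! (m + [k = 0] + [k = m])\<close>.
\<close>

subsection \<open>Power sums of the eigenvalues\<close>

text \<open>Up to the sign \<open>(-1)^j\<close>, the coefficient of \<open>e1^(m - 2j) e2^j\<close> in Waring's formula for the
  power sum \<open>x^m + y^m\<close> in terms of \<open>e1 = x + y\<close> and \<open>e2 = x y\<close>. It equals \<open>0\<close>, not \<open>2\<close>, for \<open>m = 0\<close>.\<close>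

definition power_sum_coeff :: "nat \<Rightarrow> nat \<Rightarrow> real" where
  "power_sum_coeff m j =
     (if 2 * j \<le> m then real m * fact (m - j - 1) / (fact j * fact (m - 2 * j)) else 0)"

lemma power_sum_coeff_0: "m \<ge> 1 \<Longrightarrow> power_sum_coeff m 0 = 1"
  by (simp add: power_sum_coeff_def fact_reduce[of m])

text \<open>Boundary value \<open>2 * j = m\<close>, which the quotient-of-factorials argument for
  the recurrence does not reach. The value 2 starts at \<open>i = 1\<close>, because
  \<open>power_sum_coeff 0 0 = 0\<close> by convention.\<close>

lemma power_sum_coeff_double:
  assumes "i \<ge> 1"
  shows "power_sum_coeff (2 * i) i = 2"
  using assms by (simp add: power_sum_coeff_def fact_reduce[of i])

text \<open>Coefficient form of Newton's recurrence p_(m+2) = e1 p_(m+1) - e2 p_m. It fails at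
  \<open>m = 0\<close>, \<open>i = 0\<close>, where the conventional 0 stands in for the power sum
  2.\<close>

lemma power_sum_coeff_rec:
  assumes m: "m \<ge> 1"
  shows "power_sum_coeff (m + 2) (Suc i) = power_sum_coeff (m + 1) (Suc i) + power_sum_coeff m i"
proof -
  consider "2 * i + 1 \<le> m" | "2 * i = m" | "2 * i > m" by linarith
  then show ?thesis
  proof cases
    case 1
    then obtain n where n: "m = 2 * i + 1 + n" using le_Suc_ex by blast
    have e: "Suc (Suc (Suc (2 * i + n))) - i - Suc 0 = Suc (Suc (i + n))"
       "Suc (Suc (2 * i + n)) - Suc i - Suc 0 = i + n" "Suc (2 * i + n) - i - Suc 0 = i + n"
       "Suc (2 * i + n) - 2 * i = Suc n" by auto
    \<comment> \<open>\<open>P\<close> is a common factor of all three coefficients; what remains is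
      (2i+3+n)(1+i+n) = (2i+2+n)(1+n) + (2i+1+n)(1+i).\<close>
    define P :: real where "P = fact (i + n) / (fact (Suc i) * fact (Suc n))"
    have nz: "1 + real i \<noteq> 0" "1 + real n \<noteq> 0" by linarith+
    have P: "fact (Suc (i + n)) / (fact (Suc i) * fact (Suc n)) = (1 + real i + n) * P"
      "fact (i + n) / (fact (Suc i) * fact n) = (1 + real n) * P"
      "fact (i + n) / (fact i * fact (Suc n)) = (1 + real i) * P"
      using nz by (simp_all add: P_def)
    have "power_sum_coeff (m + 2) (Suc i) = (2 * real i + 3 + n) * ((1 + real i + n) * P)"
      unfolding P(1)[symmetric] by (simp add: power_sum_coeff_def n e del: fact_Suc)
    moreover have "power_sum_coeff (m + 1) (Suc i) = (2 * real i + 2 + n) * ((1 + real n) * P)"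
      unfolding P(2)[symmetric] by (simp add: power_sum_coeff_def n e del: fact_Suc)
    moreover have "power_sum_coeff m i = (2 * real i + 1 + n) * ((1 + real i) * P)"
      unfolding P(3)[symmetric] by (simp add: power_sum_coeff_def n e del: fact_Suc)
    ultimately show ?thesis by (simp add: algebra_simps)
  next
    case 2
    then have "i \<ge> 1" "m + 2 = 2 * Suc i" using m by auto
    moreover have "power_sum_coeff (m + 1) (Suc i) = 0" using 2 by (simp add: power_sum_coeff_def)
    ultimately show ?thesis
      using power_sum_coeff_double[of i] power_sum_coeff_double[of "Suc i"] 2 by simp
  next
    case 3 then show ?thesis by (simp add: power_sum_coeff_def)
  qed
qed

text \<open>Newton's recurrence for the Waring polynomials, with \<open>t\<close> and
  \<open>d\<close> standing for trace and determinant. It follows by comparing coefficients of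
  \<open>t ^ (m - 2 * i) * d ^ Suc i\<close>.\<close>

lemma power_sum_poly_rec:
  fixes t d :: complex
  defines "F \<equiv> \<lambda>m. \<Sum>j\<le>m. of_real ((-1) ^ j * power_sum_coeff m j) * t ^ (m - 2 * j) * d ^ j"
  assumes m: "m \<ge> 1"
  shows "F (m + 2) = t * F (m + 1) - d * F m"
proof -
  let ?c = power_sum_coeff
  let ?u = "\<lambda>c i. of_real ((-1) ^ Suc i * c) * t ^ (m - 2 * i) * d ^ Suc i"
  \<comment> \<open>The top coefficients vanish, so all three sums can be taken over the same range
    \<open>i \<le> m\<close>.\<close>
  have z: "?c (m + 2) (m + 2) = 0" "?c (m + 1) (m + 1) = 0" "?c (m+2) (m+1) = 0"
    using m by (auto simp: power_sum_coeff_def)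
  have "F (m + 2) = t ^ (m + 2) + (\<Sum>i\<le>m. ?u (?c (m + 2) (Suc i)) i)"
  proof -
    have "F (m + 2) = t ^ (m + 2) + (\<Sum>i\<le>Suc m. ?u (?c (m + 2) (Suc i)) i)"
      by (simp add: F_def sum.atMost_Suc_shift[of _ "Suc m"] power_sum_coeff_0 del: sum.atMost_Suc)
    then show ?thesis using z by simp
  qed
  moreover have "t * F (m + 1) = t ^ (m + 2) + (\<Sum>i\<le>m. ?u (?c (m + 1) (Suc i)) i)"
  proof -
    \<comment> \<open>The exponent on the left is a truncated difference; where truncation would
      spoil the identity, the coefficient is 0.\<close>
    have "t * (of_real ((-1) ^ Suc i * ?c (m + 1) (Suc i)) * t ^ (m + 1 - 2 * Suc i) * d ^ Suc i)
        = ?u (?c (m + 1) (Suc i)) i" for i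
    proof (cases "2 * Suc i \<le> m + 1")
      case True
      then have "m - 2 * i = Suc (m + 1 - 2 * Suc i)" by simp
      then show ?thesis by (simp add: mult_ac)
    qed (simp add: power_sum_coeff_def)
    note e = this
    have "F (m + 1) = t ^ (m + 1) + (\<Sum>i\<le>m. of_real ((-1) ^ Suc i * ?c (m + 1) (Suc i)) * t ^ (m + 1 - 2 * Suc i) * d ^ Suc i)"
      by (simp add: F_def sum.atMost_Suc_shift[of _ m] power_sum_coeff_0 del: sum.atMost_Suc)
    then show ?thesis by (simp only: distrib_left sum_distrib_left e) simp
  qed
  moreover have "d * F m = - (\<Sum>i\<le>m. ?u (?c m i) i)"
    by (simp add: F_def sum_distrib_left sum_negf[symmetric] mult_ac)
  moreover have "?u (?c (m + 2) (Suc i)) i = ?u (?c (m + 1) (Suc i)) i + ?u (?c m i) i" for i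
    unfolding power_sum_coeff_rec[OF m] of_real_mult of_real_add by (simp add: algebra_simps)
  ultimately show ?thesis by (simp only: sum.distrib) simp
qed

text \<open>Cayley-Hamilton for 2x2 matrices, multiplied by \<open>M\<close> and traced.\<close>

lemma trace_mult_mult_2:
  fixes W M :: "complex^2^2"
  shows "trace (W ** (W ** M)) = trace W * trace (W ** M) - det W * trace M"
  by (simp add: trace_def sum_2 det_2 matrix_matrix_mult_def algebra_simps)

text \<open>Waring's formula, without reference to eigenvalues: both sides satisfy the same
  second-order recurrence. The induction carries two consecutive exponents and starts at 1 and 2,
  since at exponent 0 the trace is 2 but the formula gives 0.\<close>

lemma trace_matpow_2:
  fixes W :: "complex^2^2"
  assumes "m \<ge> 1"
  shows "trace (matpow W m) =
    (\<Sum>j\<le>m. of_real ((-1) ^ j * power_sum_coeff m j) * trace W ^ (m - 2 * j) * det W ^ j)"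
    (is "_ = ?F m")
proof -
  have t1: "trace (mat 1 :: complex^2^2) = 2" by (simp add: trace_def sum_2 mat_def)
  have c: "power_sum_coeff (Suc 0) (Suc 0) = 0" "power_sum_coeff (Suc (Suc 0)) (Suc 0) = 2"
      "power_sum_coeff (Suc (Suc 0)) (Suc (Suc 0)) = 0"
    by (simp_all add: power_sum_coeff_def)
  have "trace (matpow W (Suc n)) = ?F (Suc n) \<and>
        trace (matpow W (Suc (Suc n))) = ?F (Suc (Suc n))" for n
  proof (induction n)
    case 0
    show ?case
      using trace_mult_mult_2[of W "mat 1"]
      by (simp add: t1 c power_sum_coeff_0)
  next
    case (Suc n)
    have "trace (matpow W (Suc n + 2)) = trace W * trace (matpow W (Suc n + 1)) - det W * trace (matpow W (Suc n))"
      using trace_mult_mult_2[of W "matpow W (Suc n)"] by simp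
    also have "\<dots> = ?F (Suc n + 2)"
      using Suc power_sum_poly_rec[of "Suc n" "trace W" "det W"] by simp
    finally show ?case using Suc by simp
  qed
  from this[of "m - 1"] assms show ?thesis by simp
qed

section \<open>Evaluation of the alternating binomial sum\<close>

text \<open>Up to the sign \<open>(-1) ^ b\<close>, this is the coefficient of z^b in (1+z)^a
  (1+z)^(1-a) = 1+z, which is 0 once \<open>b \<ge> 2\<close>. Upper negation turns the second
  binomial into one with upper entry \<open>1 - a\<close>.\<close>

lemma alternating_binomial_sum:
  assumes "a \<ge> 2" "b \<ge> 2"
  shows "(\<Sum>i\<le>b. (-1) ^ i * real (a choose i) * real ((a - 2 + (b - i)) choose (b - i))) = 0"
proof -
  have g: "((1 - real a) gchoose k) = (-1) ^ k * real ((a - 2 + k) choose k)" for k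
    using gbinomial_minus[of "real a - 1" k] assms
    by (simp add: binomial_gbinomial algebra_simps)
  have "(-1) ^ b * (\<Sum>i\<le>b. (-1) ^ i * real (a choose i) * real ((a - 2 + (b - i)) choose (b - i)))
    = (\<Sum>i\<le>b. (real a gchoose i) * ((1 - real a) gchoose (b - i)))"
    unfolding sum_distrib_left g binomial_gbinomial[symmetric]
  proof (intro sum.cong refl, goal_cases)
    case (1 i)
    then have "(-1::real) ^ b = (-1) ^ i * (-1) ^ (b - i)"
      by (simp flip: power_add)
    moreover have "(-1::real) ^ i * (-1) ^ i = 1" by (simp flip: power_mult_distrib)
    ultimately show ?case by (simp add: algebra_simps)
  qed
  also have "\<dots> = ((1::real) gchoose b)"
    using gbinomial_Vandermonde[of "real a" "1 - real a" b] by (simp add: atLeast0AtMost)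
  also have "\<dots> = 0" using assms binomial_gbinomial[of 1 b, where 'a=real] by (simp add: binomial_eq_0)
  finally show ?thesis by simp
qed

text \<open>The left side is the coefficient of \<open>d1 ^ k * d2 ^ (m - k)\<close> in the expected
  trace. With i = j + 1 it becomes the alternating sum above with its i = 0 term missing; for k = 0
  or k = m only j = 0 survives.\<close>

lemma power_sum_coeff_binomial_sum:
  assumes m: "m \<ge> 1" and k: "k \<le> m"
  shows "(\<Sum>j\<le>m. (-1) ^ j * power_sum_coeff m j * fact (m - 2 * j) * fact j * fact (Suc j) *
            real (Suc k choose Suc j) * real (Suc (m - k) choose Suc j))
       = fact m * (real m + of_bool (k = 0) + of_bool (k = m))"
proof -
  let ?f = "\<lambda>j. (-1) ^ j * fact (m - Suc j) * fact (Suc j) *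
            real (Suc k choose Suc j) * real (Suc (m - k) choose Suc j)"
  have "(\<Sum>j\<le>m. (-1) ^ j * power_sum_coeff m j * fact (m - 2 * j) * fact j * fact (Suc j) *
            real (Suc k choose Suc j) * real (Suc (m - k) choose Suc j)) = (\<Sum>j\<le>m. real m * ?f j)"
  proof (intro sum.cong refl, goal_cases)
    case (1 j)
    show ?case
    proof (cases "2 * j \<le> m")
      case True then show ?thesis by (simp add: power_sum_coeff_def)
    next
      case False
      \<comment> \<open>For \<open>2 * j > m\<close> the left side is 0 by definition of the
        coefficient, and the right side because one of the binomials is.\<close>
      then have "k < j \<or> m - k < j" by linarith
      then show ?thesis by (auto simp: binomial_eq_0)
    qed
  qed
  also have "\<dots> = real m * (\<Sum>j\<le>m. ?f j)" by (simp only: sum_distrib_left)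
  also have "\<dots> = fact m * (real m + of_bool (k = 0) + of_bool (k = m))"
  proof (cases "k = 0 \<or> k = m")
    case True
    have "(\<Sum>j\<le>m. ?f j) = (\<Sum>j\<in>{0}. ?f j)"
      by (rule sum.mono_neutral_right) (use True in \<open>auto simp: binomial_eq_0\<close>)
    also have "\<dots> = fact (m - 1) * (real m + 1)" using True by auto
    finally show ?thesis using True m by (cases m) (auto simp: algebra_simps)
  next
    case False
    define a b where "a = Suc k" and "b = Suc (m - k)"
    have ab: "a \<ge> 2" "b \<ge> 2" "a + b = m + 2" "b \<le> m" using False k by (auto simp: a_def b_def)
    let ?g = "\<lambda>i. (-1) ^ i * fact (m - i) * fact i * real (a choose i) * real (b choose i)"
    have "(\<Sum>i\<le>Suc m. ?g i) = (\<Sum>i\<le>b. ?g i)"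
      by (rule sum.mono_neutral_right) (use ab in \<open>auto simp: binomial_eq_0\<close>)
    also have "\<dots> = (\<Sum>i\<le>b. fact b * fact (a - 2) *
       ((-1) ^ i * real (a choose i) * real ((a - 2 + (b - i)) choose (b - i))))"
    proof (intro sum.cong refl, goal_cases)
      case (1 i)
      then have "m - i = a - 2 + (b - i)" using ab by auto
      then have "fact (a - 2) * real ((a - 2 + (b - i)) choose (b - i)) = fact (m - i) / fact (b - i)"
        by (simp add: binomial_fact)
      moreover have "fact i * real (b choose i) = fact b / fact (b - i)"
        using 1 by (simp add: binomial_fact)
      moreover have "?g i = (-1) ^ i * real (a choose i) * fact (m - i) * (fact i * real (b choose i))"
        by simp
      ultimately show ?case by (simp add: mult_ac)
    qed
    also have "\<dots> = 0" unfolding sum_distrib_left[symmetric] using alternating_binomial_sum[OF ab(1,2)] by simp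
    \<comment> \<open>The i = 0 term is \<open>fact m\<close>, and the shift i = j + 1 reverses the
      sign of the rest.\<close>
    finally have "fact m - (\<Sum>j\<le>m. ?f j) = 0"
      unfolding sum.atMost_Suc_shift by (simp add: a_def b_def sum_negf del: binomial_Suc_Suc fact_Suc)
    with False show ?thesis by simp
  qed
  finally show ?thesis .
qed

text \<open>Substitute k = p + j; the binomials vanish for k outside \<open>{j..m - j}\<close>. The
  new range no longer depends on \<open>j\<close>, which later permits exchanging the two
  sums.\<close>

lemma binomial_convolution_shift:
  assumes "2 * j \<le> m"
  shows "(\<Sum>p\<le>m - 2 * j. real (p + j + 1 choose (j + 1)) * real (m - 2 * j - p + j + 1 choose (j + 1)) *
             (x * y) ^ j * x ^ p * y ^ (m - 2 * j - p))
       = (\<Sum>k\<le>m. real (Suc k choose Suc j) * real (Suc (m - k) choose Suc j) * x ^ k * (y::real) ^ (m - k))"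
proof -
  have "(\<Sum>k\<le>m. real (Suc k choose Suc j) * real (Suc (m - k) choose Suc j) * x ^ k * y ^ (m - k))
     = (\<Sum>k\<in>{j..m - j}. real (Suc k choose Suc j) * real (Suc (m - k) choose Suc j) * x ^ k * y ^ (m - k))"
    by (rule sum.mono_neutral_right) (use assms in \<open>auto simp: binomial_eq_0\<close>)
  also have "\<dots> = (\<Sum>p\<le>m - 2 * j. real (p + j + 1 choose (j + 1)) * real (m - 2 * j - p + j + 1 choose (j + 1)) *
             (x * y) ^ j * x ^ p * y ^ (m - 2 * j - p))"
  proof (rule sum.reindex_bij_witness[of _ "\<lambda>p. p + j" "\<lambda>k. k - j"], goal_cases)
    case (5 k)
    define p where "p = k - j"
    have "k = p + j" "m - k = m - 2 * j - p + j" using 5 assms by (auto simp: p_def)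
    then show ?case unfolding p_def[symmetric]
      by (simp add: power_add power_mult_distrib mult_ac del: binomial_Suc_Suc)
  qed (use assms in auto)
  finally show ?thesis ..
qed

subsection \<open>Invariance of Lebesgue measure and Gaussian moments\<close>

text \<open>Such a map only relabels coordinates, so the preimage of an open box is a box with the
  same side lengths, and boxes determine Lebesgue measure.\<close>

lemma lborel_distr_basis:
  fixes f :: "'a::euclidean_space \<Rightarrow> 'b::euclidean_space"
  assumes [measurable]: "f \<in> borel_measurable borel"
    and bij: "bij_betw f Basis Basis"
    and inner: "\<And>x b. b \<in> Basis \<Longrightarrow> f x \<bullet> f b = x \<bullet> b"
  shows "distr lborel borel f = lborel"
proof (rule lborel_eqI[symmetric])
  fix l u :: 'b
  assume le: "\<And>b. b \<in> Basis \<Longrightarrow> l \<bullet> b \<le> u \<bullet> b"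
  have fB: "f b \<in> Basis" if "b \<in> Basis" for b using bij that by (auto dest: bij_betwE)
  define g :: "'b \<Rightarrow> 'a" where "g y = (\<Sum>b\<in>Basis. (y \<bullet> f b) *\<^sub>R b)" for y
  have g: "g y \<bullet> b = y \<bullet> f b" if "b \<in> Basis" for y b
    using that by (simp add: g_def)
  have "f -` box l u = box (g l) (g u)"
  proof -
    have "f x \<in> box l u \<longleftrightarrow> x \<in> box (g l) (g u)" for x
    proof -
      have "f x \<in> box l u \<longleftrightarrow> (\<forall>i\<in>f ` Basis. l \<bullet> i < f x \<bullet> i \<and> f x \<bullet> i < u \<bullet> i)"
        using bij by (simp add: mem_box bij_betw_def)
      then show ?thesis by (simp add: mem_box inner g)
    qed
    then show ?thesis by auto
  qed
  then have "emeasure (distr lborel borel f) (box l u) = emeasure lborel (box (g l) (g u))"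
    by (simp add: emeasure_distr)
  also have "\<dots> = (\<Prod>b\<in>Basis. (g u - g l) \<bullet> b)"
    by (rule emeasure_lborel_box) (simp add: g le fB)
  also have "(\<Prod>b\<in>Basis. (g u - g l) \<bullet> b) = (\<Prod>b\<in>Basis. (u - l) \<bullet> f b)"
    by (intro prod.cong refl) (simp add: inner_diff_left g)
  also have "\<dots> = (\<Prod>b\<in>Basis. (u - l) \<bullet> b)"
    by (rule prod.reindex_bij_betw[OF bij])
  finally show "emeasure (distr lborel borel f) (box l u) = ennreal (\<Prod>b\<in>Basis. (u - l) \<bullet> b)" .
qed simp

section \<open>Matrices as pairs of rows or pairs of columns\<close>

text \<open>Row coordinates serve the moment computation, which integrates over one row while the
  other is fixed.\<close>

definition of_rows :: "('a \<times> 'a) \<times> ('a \<times> 'a) \<Rightarrow> 'a^2^2" where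
  "of_rows p = (\<chi> i j. (if j = 1 then fst else snd) ((if i = 1 then fst else snd) p))"

text \<open>Column coordinates serve unitary invariance: left multiplication acts on each column
  separately.\<close>

definition of_columns :: "('a \<times> 'a) \<times> ('a \<times> 'a) \<Rightarrow> 'a^2^2" where
  "of_columns p = (\<chi> i j. (if i = 1 then fst else snd) ((if j = 1 then fst else snd) p))"

lemma of_rows_nth [simp]:
  "of_rows p $ 1 $ 1 = fst (fst p)" "of_rows p $ 1 $ 2 = snd (fst p)"
  "of_rows p $ 2 $ 1 = fst (snd p)" "of_rows p $ 2 $ 2 = snd (snd p)"
  by (simp_all add: of_rows_def)

lemma of_columns_nth [simp]:
  "of_columns p $ 1 $ 1 = fst (fst p)" "of_columns p $ 2 $ 1 = snd (fst p)"
  "of_columns p $ 1 $ 2 = fst (snd p)" "of_columns p $ 2 $ 2 = snd (snd p)"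
  by (simp_all add: of_columns_def)

lemma mat2_eq_iff:
  "(A :: 'a^2^2) = B \<longleftrightarrow> A$1$1 = B$1$1 \<and> A$1$2 = B$1$2 \<and> A$2$1 = B$2$1 \<and> A$2$2 = B$2$2"
  by (auto simp: vec_eq_iff forall_2)

lemma borel_measurable_of_rows [measurable]:
  "(of_rows :: _ \<Rightarrow> 'a::euclidean_space^2^2) \<in> borel_measurable borel"
  unfolding of_rows_def
  by (intro borel_measurable_continuous_onI continuous_on_vec_lambda) (auto intro!: continuous_on_fst continuous_on_snd continuous_on_id)

lemma borel_measurable_of_columns [measurable]:
  "(of_columns :: _ \<Rightarrow> 'a::euclidean_space^2^2) \<in> borel_measurable borel"
  unfolding of_columns_def
  by (intro borel_measurable_continuous_onI continuous_on_vec_lambda) (auto intro!: continuous_on_fst continuous_on_snd continuous_on_id)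

lemma Basis_mat2:
  "(Basis :: ('a::euclidean_space^2^2) set) =
     (\<lambda>b. axis 1 (axis 1 b)) ` Basis \<union> (\<lambda>b. axis 1 (axis 2 b)) ` Basis \<union>
     (\<lambda>b. axis 2 (axis 1 b)) ` Basis \<union> (\<lambda>b. axis 2 (axis 2 b)) ` Basis"
  by (auto simp: Basis_vec_def UNIV_2)

lemma Basis_prod2:
  "(Basis :: (('a::euclidean_space \<times> 'a) \<times> ('a \<times> 'a)) set) =
     (\<lambda>b. ((b, 0), 0)) ` Basis \<union> (\<lambda>b. ((0, b), 0)) ` Basis \<union>
     (\<lambda>b. (0, (b, 0))) ` Basis \<union> (\<lambda>b. (0, (0, b))) ` Basis"
  by (auto simp: Basis_prod_def)

lemma axis_mat2_nth:
  "axis (1::2) x $ 1 = x" "axis (2::2) x $ 2 = x" "axis (1::2) x $ 2 = 0" "axis (2::2) x $ 1 = 0"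
  by (simp_all add: axis_def)

lemma lborel_distr_of_rows: "distr lborel borel of_rows = (lborel :: ('a::euclidean_space^2^2) measure)"
proof (rule lborel_distr_basis)
  have e: "of_rows ((b, 0), 0) = axis 1 (axis 1 b)" "of_rows ((0, b), 0) = axis 1 (axis 2 b)"
    "of_rows (0, (b, 0)) = axis 2 (axis 1 b)" "of_rows (0, (0, b)) = axis 2 (axis 2 b)" for b :: 'a
    by (simp_all add: mat2_eq_iff axis_mat2_nth)
  show "bij_betw (of_rows :: _ \<Rightarrow> 'a^2^2) Basis Basis"
    unfolding bij_betw_def
  proof
    show "inj_on (of_rows :: _ \<Rightarrow> 'a^2^2) Basis"
      by (auto intro!: inj_onI simp: mat2_eq_iff prod_eq_iff)
    show "of_rows ` Basis = (Basis :: ('a^2^2) set)"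
      unfolding Basis_mat2 Basis_prod2 image_Un image_image e ..
  qed
  show "of_rows x \<bullet> of_rows b = x \<bullet> b" for x b :: "('a \<times> 'a) \<times> ('a \<times> 'a)"
    by (simp add: inner_vec_def sum_2 inner_prod_def)
qed simp

lemma lborel_distr_of_columns: "distr lborel borel of_columns = (lborel :: ('a::euclidean_space^2^2) measure)"
proof (rule lborel_distr_basis)
  have e: "of_columns ((b, 0), 0) = axis 1 (axis 1 b)" "of_columns ((0, b), 0) = axis 2 (axis 1 b)"
    "of_columns (0, (b, 0)) = axis 1 (axis 2 b)" "of_columns (0, (0, b)) = axis 2 (axis 2 b)" for b :: 'a
    by (simp_all add: mat2_eq_iff axis_mat2_nth)
  show "bij_betw (of_columns :: _ \<Rightarrow> 'a^2^2) Basis Basis"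
    unfolding bij_betw_def
  proof
    show "inj_on (of_columns :: _ \<Rightarrow> 'a^2^2) Basis"
      by (auto intro!: inj_onI simp: mat2_eq_iff prod_eq_iff)
    show "of_columns ` Basis = (Basis :: ('a^2^2) set)"
      unfolding Basis_mat2 Basis_prod2 image_Un image_image e by blast
  qed
  show "of_columns x \<bullet> of_columns b = x \<bullet> b" for x b :: "('a \<times> 'a) \<times> ('a \<times> 'a)"
    by (simp add: inner_vec_def sum_2 inner_prod_def)
qed simp

lemma nn_integral_lborel_Pair:
  fixes f :: "'a::euclidean_space \<times> 'b::euclidean_space \<Rightarrow> ennreal"
  assumes [measurable]: "f \<in> borel_measurable borel"
  shows "(\<integral>\<^sup>+p. f p \<partial>lborel) = (\<integral>\<^sup>+x. \<integral>\<^sup>+y. f (x, y) \<partial>lborel \<partial>lborel)"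
    and "(\<integral>\<^sup>+p. f p \<partial>lborel) = (\<integral>\<^sup>+y. \<integral>\<^sup>+x. f (x, y) \<partial>lborel \<partial>lborel)"
proof -
  have [measurable]: "f \<in> borel_measurable (lborel \<Otimes>\<^sub>M lborel)"
    by (simp add: lborel_prod)
  show "(\<integral>\<^sup>+p. f p \<partial>lborel) = (\<integral>\<^sup>+x. \<integral>\<^sup>+y. f (x, y) \<partial>lborel \<partial>lborel)"
    unfolding lborel_prod[symmetric] by (rule lborel.nn_integral_fst[symmetric]) simp
  show "(\<integral>\<^sup>+p. f p \<partial>lborel) = (\<integral>\<^sup>+y. \<integral>\<^sup>+x. f (x, y) \<partial>lborel \<partial>lborel)"
    unfolding lborel_prod[symmetric] by (rule lborel_pair.nn_integral_snd[symmetric]) simp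
qed

lemma lborel_distr_eqI:
  fixes T :: "'a::euclidean_space \<Rightarrow> 'a"
  assumes [measurable]: "T \<in> borel_measurable borel"
    and "\<And>f. f \<in> borel_measurable borel \<Longrightarrow> (\<integral>\<^sup>+x. f (T x) \<partial>lborel) = (\<integral>\<^sup>+x. f x \<partial>lborel)"
  shows "distr lborel borel T = lborel"
proof (rule measure_eqI)
  fix A assume "A \<in> sets (distr lborel borel T)"
  then have [measurable]: "A \<in> sets borel" by simp
  have "emeasure (distr lborel borel T) A = (\<integral>\<^sup>+x. indicator A x \<partial>distr lborel borel T)"
    by simp
  also have "\<dots> = (\<integral>\<^sup>+x. indicator A (T x) \<partial>lborel)"
    by (rule nn_integral_distr) simp_all
  also have "\<dots> = emeasure lborel A"
    by (subst assms(2)) simp_all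
  finally show "emeasure (distr lborel borel T) A = emeasure lborel A" .
qed simp

lemma nn_integral_lborel_translate:
  fixes c :: "'a::euclidean_space"
  assumes [measurable]: "f \<in> borel_measurable borel"
  shows "(\<integral>\<^sup>+x. f (x + c) \<partial>lborel) = (\<integral>\<^sup>+x. f x \<partial>lborel)"
  by (subst (2) lborel_distr_plus[of c, symmetric]) (simp add: nn_integral_distr add.commute)

section \<open>Complex linear maps of determinant one\<close>

text \<open>By Tonelli: for a fixed second coordinate, the shear is a translation of the
  first.\<close>

lemma lborel_distr_upper_shear:
  fixes u :: complex
  shows "distr lborel borel (\<lambda>p. (fst p + u * snd p, snd p)) = lborel"
proof (rule lborel_distr_eqI)
  fix f :: "complex \<times> complex \<Rightarrow> ennreal"
  assume [measurable]: "f \<in> borel_measurable borel"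
  have [measurable]: "(\<lambda>x. f (x, y)) \<in> borel_measurable borel" for y
    by (rule measurable_compose[OF _ \<open>f \<in> _\<close>]) (intro borel_measurable_continuous_onI continuous_intros)
  have [measurable]: "(\<lambda>p. f (fst p + u * snd p, snd p)) \<in> borel_measurable borel"
    by (rule measurable_compose[OF _ \<open>f \<in> _\<close>]) (intro borel_measurable_continuous_onI continuous_intros)
  show "(\<integral>\<^sup>+p. f (fst p + u * snd p, snd p) \<partial>lborel) = (\<integral>\<^sup>+p. f p \<partial>lborel)"
    using nn_integral_lborel_translate[where f="\<lambda>x. f (x, _)"]
    by (simp add: nn_integral_lborel_Pair(2))
qed (intro borel_measurable_continuous_onI continuous_intros)

lemma lborel_distr_lower_shear:
  fixes u :: complex
  shows "distr lborel borel (\<lambda>p. (fst p, u * fst p + snd p)) = lborel"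
proof (rule lborel_distr_eqI)
  fix f :: "complex \<times> complex \<Rightarrow> ennreal"
  assume [measurable]: "f \<in> borel_measurable borel"
  have [measurable]: "(\<lambda>y. f (x, y)) \<in> borel_measurable borel" for x
    by (rule measurable_compose[OF _ \<open>f \<in> _\<close>]) (intro borel_measurable_continuous_onI continuous_intros)
  have [measurable]: "(\<lambda>p. f (fst p, u * fst p + snd p)) \<in> borel_measurable borel"
    by (rule measurable_compose[OF _ \<open>f \<in> _\<close>]) (intro borel_measurable_continuous_onI continuous_intros)
  show "(\<integral>\<^sup>+p. f (fst p, u * fst p + snd p) \<partial>lborel) = (\<integral>\<^sup>+p. f p \<partial>lborel)"
  proof -
    have "(\<integral>\<^sup>+y. f (x, u * x + y) \<partial>lborel) = (\<integral>\<^sup>+y. f (x, y) \<partial>lborel)" for x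
      using nn_integral_lborel_translate[of "\<lambda>y. f (x, y)" "u * x"] by (simp add: add.commute)
    then show ?thesis by (simp add: nn_integral_lborel_Pair(1))
  qed
qed (intro borel_measurable_continuous_onI continuous_intros)

definition lin2 :: "complex \<Rightarrow> complex \<Rightarrow> complex \<Rightarrow> complex \<Rightarrow> complex \<times> complex \<Rightarrow> complex \<times> complex" where
  "lin2 a b c d p = (a * fst p + b * snd p, c * fst p + d * snd p)"

lemma borel_measurable_lin2 [measurable]: "lin2 a b c d \<in> borel_measurable borel"
  unfolding lin2_def by (intro borel_measurable_continuous_onI continuous_intros)

lemma lborel_distr_comp:
  assumes [measurable]: "f \<in> borel_measurable borel" "g \<in> borel_measurable borel"
    and "distr lborel borel f = (lborel :: 'a::euclidean_space measure)"
    and "distr lborel borel g = (lborel :: 'a measure)"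
  shows "distr lborel borel (f \<circ> g) = lborel"
proof -
  have "distr lborel borel (f \<circ> g) = distr (distr lborel borel g) borel f"
    by (rule distr_distr[symmetric]) simp_all
  then show ?thesis using assms by simp
qed

text \<open>A matrix of determinant one is a product of shears.\<close>

lemma lborel_distr_lin2:
  assumes "a * d - b * c = 1"
  shows "distr lborel borel (lin2 a b c d) = lborel"
proof -
  have nonzero: "distr lborel borel (lin2 a b c d) = lborel"
    if "c \<noteq> 0" "a * d - b * c = 1" for a b c d
  proof -
    let ?S = "\<lambda>u p. (fst p + u * snd p, snd p) :: complex \<times> complex"
    let ?L = "\<lambda>p. (fst p, c * fst p + snd p) :: complex \<times> complex"
    \<comment> \<open>For \<open>c \<noteq> 0\<close> the determinant condition fixes
      \<open>b\<close>, and the matrix factors as upper, lower, upper shear with parameters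
      \<open>(a - 1) / c\<close>, \<open>c\<close>, \<open>(d - 1) / c\<close>.\<close>
    have b: "b = (a * d - 1) / c" using that by (simp add: field_simps)
    have "distr lborel borel (?S ((a - 1) / c) \<circ> (?L \<circ> ?S ((d - 1) / c))) = lborel"
      by (intro lborel_distr_comp lborel_distr_upper_shear lborel_distr_lower_shear measurable_comp
          borel_measurable_continuous_onI continuous_intros)
    moreover have "?S ((a - 1) / c) \<circ> (?L \<circ> ?S ((d - 1) / c)) = lin2 a b c d"
      using that(1) unfolding b by (auto simp: fun_eq_iff lin2_def field_simps)
    ultimately show ?thesis by simp
  qed
  show ?thesis
  proof (cases "c = 0")
    case True
    \<comment> \<open>Splitting off a quarter turn leaves two factors of determinant one whose lower
      left entries are 1 and \<open>-a\<close>; both are nonzero, as \<open>a * d = 1\<close>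
      here.\<close>
    have "lin2 a b c d = lin2 0 (-1) 1 0 \<circ> lin2 c d (-a) (-b)"
      by (auto simp: fun_eq_iff lin2_def)
    moreover have "distr lborel borel (lin2 0 (-1) 1 0 \<circ> lin2 c d (-a) (-b)) = lborel"
      using assms True by (intro lborel_distr_comp nonzero borel_measurable_lin2) (auto simp: mult.commute)
    ultimately show ?thesis by simp
  qed (use nonzero assms in blast)
qed

section \<open>Radial integrals and Gaussian moments in one and two complex variables\<close>

text \<open>The area of a disc is linear in its squared radius. The minus sign makes the preimage of
  each ray \<open>{x<..}\<close> a disc, of finite measure, as the uniqueness criterion for measures
  on the line requires.\<close>

lemma lborel_distr_cmod_square:
  "distr lborel borel (\<lambda>z::complex. - (cmod z)\<^sup>2) =
   density lborel (\<lambda>t. ennreal pi * indicator {..0} t)"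
proof (rule measure_eqI_lessThan)
  fix x :: real
  have 1: "emeasure (distr lborel borel (\<lambda>z::complex. - (cmod z)\<^sup>2)) {x<..} = ennreal (pi * max 0 (- x))"
  proof -
    have "(\<lambda>z::complex. - (cmod z)\<^sup>2) -` {x<..} = ball 0 (sqrt (max 0 (- x)))"
    proof (cases "x \<le> 0")
      case True
      have "x < - (cmod z)\<^sup>2 \<longleftrightarrow> cmod z < sqrt (- x)" for z
        using real_less_rsqrt[of "cmod z" "- x"] sqrt_le_D[of "- x" "cmod z"] True
        by (smt (verit) norm_ge_zero real_sqrt_abs real_sqrt_less_iff abs_of_nonneg)
      then show ?thesis using True by (auto simp: max_def)
    next
      case False
      then show ?thesis by (auto simp: max_def) (smt (verit) zero_le_power2)
    qed
    then show ?thesis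
      by (simp add: emeasure_distr emeasure_ball unit_ball_vol_2 max_def)
  qed
  have 2: "emeasure (density lborel (\<lambda>t. ennreal pi * indicator {..0} t)) {x<..} = ennreal (pi * max 0 (- x))"
  proof -
    have "emeasure (density lborel (\<lambda>t. ennreal pi * indicator {..0} t)) {x<..}
        = (\<integral>\<^sup>+t. ennreal pi * indicator {x<..0} t \<partial>lborel)"
      by (subst emeasure_density) (auto intro!: nn_integral_cong split: split_indicator)
    also have "\<dots> = ennreal (pi * max 0 (- x))"
      by (cases "x \<le> 0") (auto simp: nn_integral_cmult ennreal_mult'[symmetric] max_def)
    finally show ?thesis .
  qed
  show "emeasure (distr lborel borel (\<lambda>z::complex. - (cmod z)\<^sup>2)) {x<..} < \<infinity>"
    unfolding 1 by simp
  show "emeasure (distr lborel borel (\<lambda>z::complex. - (cmod z)\<^sup>2)) {x<..} =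
      emeasure (density lborel (\<lambda>t. ennreal pi * indicator {..0} t)) {x<..}"
    unfolding 1 2 ..
qed simp_all

text \<open>Polar coordinates in the variable t = |z|^2 with the angle integrated out; the
  reflection of the line undoes the sign in the previous lemma.\<close>

lemma nn_integral_cmod_square:
  fixes f :: "real \<Rightarrow> ennreal"
  assumes [measurable]: "f \<in> borel_measurable borel"
  shows "(\<integral>\<^sup>+z. f ((cmod z)\<^sup>2) \<partial>lborel) = ennreal pi * (\<integral>\<^sup>+t. f t * indicator {0..} t \<partial>lborel)"
proof -
  have "(\<integral>\<^sup>+z. f ((cmod z)\<^sup>2) \<partial>lborel) = (\<integral>\<^sup>+t. f (- t) \<partial>distr lborel borel (\<lambda>z::complex. - (cmod z)\<^sup>2))"
    by (subst nn_integral_distr) simp_all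
  also have "\<dots> = (\<integral>\<^sup>+t. ennreal pi * (f (- t) * indicator {0..} (- t)) \<partial>lborel)"
    unfolding lborel_distr_cmod_square
    by (subst nn_integral_density) (auto intro!: nn_integral_cong simp: mult_ac split: split_indicator)
  also have "\<dots> = (\<integral>\<^sup>+t. ennreal pi * (f t * indicator {0..} t) \<partial>distr lborel borel uminus)"
    by (subst nn_integral_distr) simp_all
  finally show ?thesis by (simp add: lborel_distr_uminus nn_integral_cmult)
qed

lemma nn_integral_complex_gaussian_moment:
  "(\<integral>\<^sup>+z. ennreal ((cmod z) ^ (2 * n) * exp (- (cmod z)\<^sup>2)) \<partial>lborel) = ennreal (pi * fact n)"
proof -
  have "(\<integral>\<^sup>+z. ennreal (((cmod z)\<^sup>2) ^ n * exp (- (cmod z)\<^sup>2)) \<partial>lborel) = ennreal pi * ennreal (fact n)"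
    using nn_integral_cmod_square[of "\<lambda>t. ennreal (t ^ n * exp (- t))"]
    by (simp add: nn_intergal_power_times_exp_Ici)
  then show ?thesis by (simp add: power_mult ennreal_mult)
qed

lemma borel_measurable_fst_snd_complex [measurable]:
  "(\<lambda>p::complex\<times>complex. fst p) \<in> borel_measurable borel"
  "(\<lambda>p::complex\<times>complex. snd p) \<in> borel_measurable borel"
  by (intro borel_measurable_continuous_onI continuous_intros)+

definition sq_norm :: "complex \<times> complex \<Rightarrow> real" where
  "sq_norm p = (cmod (fst p))\<^sup>2 + (cmod (snd p))\<^sup>2"

lemma sq_norm_nonneg [simp]: "sq_norm p \<ge> 0"
  by (simp add: sq_norm_def)

lemma borel_measurable_sq_norm [measurable]: "sq_norm \<in> borel_measurable borel"
  unfolding sq_norm_def by measurable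

text \<open>Expanding \<open>sq_norm p ^ s\<close> binomially separates the two variables. Each term
  contributes \<open>fact s * fact j\<close> times a binomial coefficient, and the hockey-stick
  identity adds these up.\<close>

lemma nn_integral_gaussian_pair_moment:
  "(\<integral>\<^sup>+p. ennreal (sq_norm p ^ s * cmod (snd p) ^ (2 * j) * exp (- sq_norm p)) \<partial>lborel)
   = ennreal (pi\<^sup>2 * (fact s * fact j * real ((s + j + 1) choose (j + 1))))"
proof -
  let ?g = "\<lambda>n z. ennreal (cmod z ^ (2 * n) * exp (- (cmod z)\<^sup>2))"
  have [measurable]: "?g n \<in> borel_measurable borel" for n by measurable
  have [measurable]: "(\<lambda>p. ?g n (fst p) * ?g k (snd p)) \<in> borel_measurable borel" for n k by measurable
  have prod: "(\<integral>\<^sup>+p. ?g n (fst p) * ?g k (snd p) \<partial>lborel) = ennreal (pi * fact n) * ennreal (pi * fact k)" for n k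
    by (subst nn_integral_lborel_Pair(1), measurable)
       (simp add: nn_integral_cmult nn_integral_multc nn_integral_complex_gaussian_moment)
  have "(\<integral>\<^sup>+p. ennreal (sq_norm p ^ s * cmod (snd p) ^ (2 * j) * exp (- sq_norm p)) \<partial>lborel)
     = (\<integral>\<^sup>+p. (\<Sum>q\<le>s. ennreal (real (s choose q)) * (?g q (fst p) * ?g (s - q + j) (snd p))) \<partial>lborel)"
  proof (intro nn_integral_cong)
    fix p :: "complex \<times> complex"
    have "sq_norm p ^ s * cmod (snd p) ^ (2 * j) * exp (- sq_norm p) =
      (\<Sum>q\<le>s. real (s choose q) * ((cmod (fst p) ^ (2 * q) * exp (- (cmod (fst p))\<^sup>2))
         * (cmod (snd p) ^ (2 * (s - q + j)) * exp (- (cmod (snd p))\<^sup>2))))"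
      unfolding sq_norm_def binomial_ring sum_distrib_right minus_add_distrib exp_add
      unfolding power_mult power_add by (intro sum.cong refl) (simp add: mult_ac)
    then show "ennreal (sq_norm p ^ s * cmod (snd p) ^ (2 * j) * exp (- sq_norm p)) =
       (\<Sum>q\<le>s. ennreal (real (s choose q)) * (?g q (fst p) * ?g (s - q + j) (snd p)))"
      by (simp add: sum_ennreal[symmetric] ennreal_mult)
  qed
  also have "\<dots> = (\<Sum>q\<le>s. ennreal (real (s choose q)) * (ennreal (pi * fact q) * ennreal (pi * fact (s - q + j))))"
    by (simp add: nn_integral_sum nn_integral_cmult prod)
  also have "\<dots> = ennreal (\<Sum>q\<le>s. real (s choose q) * (pi * fact q * (pi * fact (s - q + j))))"
    by (simp add: sum_ennreal[symmetric] ennreal_mult)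
  also have "(\<Sum>q\<le>s. real (s choose q) * (pi * fact q * (pi * fact (s - q + j))))
     = (\<Sum>q\<le>s. pi\<^sup>2 * (fact s * fact j * real ((j + (s - q)) choose j)))"
    by (intro sum.cong refl) (simp add: binomial_fact power2_eq_square add.commute)
  also have "\<dots> = pi\<^sup>2 * (fact s * fact j * (\<Sum>q\<le>s. real ((j + (s - q)) choose j)))"
    by (simp only: sum_distrib_left)
  also have "(\<Sum>q\<le>s. real ((j + (s - q)) choose j)) = (\<Sum>q\<le>s. real ((j + q) choose j))"
    by (rule sum.reindex_bij_witness[of _ "\<lambda>q. s - q" "\<lambda>q. s - q"]) auto
  also have "\<dots> = real ((s + j + 1) choose (j + 1))"
    using choose_rising_sum(1)[of j s] by (simp add: add.commute flip: of_nat_sum)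
  finally show ?thesis .
qed

text \<open>Normalizing \<open>p\<close> to a unit vector \<open>(a, b)\<close> gives an element of
  SU(2) whose second coordinate at \<open>q\<close> is the determinant of the rows \<open>p\<close>,
  \<open>q\<close> divided by the length of \<open>p\<close>.\<close>

lemma cmod_rotate_det:
  assumes "sq_norm p \<noteq> 0"
  obtains a b where "cmod a ^ 2 + cmod b ^ 2 = 1"
    "\<And>q. cmod (fst p * snd q - snd p * fst q) ^ 2 = sq_norm p * cmod (snd (lin2 (cnj a) (cnj b) (- b) a q)) ^ 2"
proof -
  define r where "r = sqrt (sq_norm p)"
  have r: "r > 0" "r\<^sup>2 = sq_norm p" using assms sq_norm_nonneg[of p] by (auto simp: r_def less_le)
  show ?thesis
  proof (rule that[of "fst p / r" "snd p / r"])
    show "cmod (fst p / r) ^ 2 + cmod (snd p / r) ^ 2 = 1"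
      using r assms by (simp add: norm_divide power_divide sq_norm_def flip: add_divide_distrib)
    fix q
    have "snd (lin2 (cnj (fst p / r)) (cnj (snd p / r)) (- (snd p / r)) (fst p / r) q)
       = (fst p * snd q - snd p * fst q) / r"
      by (simp add: lin2_def diff_divide_distrib)
    then show "cmod (fst p * snd q - snd p * fst q) ^ 2 = 
       sq_norm p * cmod (snd (lin2 (cnj (fst p / r)) (cnj (snd p / r)) (- (snd p / r)) (fst p / r) q)) ^ 2"
      using r by (simp add: norm_divide power_divide flip: r(2))
  qed
qed

lemma sq_norm_eq_complex: "complex_of_real (sq_norm p) = fst p * cnj (fst p) + snd p * cnj (snd p)"
  by (simp add: sq_norm_def complex_norm_square del: of_real_power)

lemma sq_norm_lin2:
  assumes "cmod a ^ 2 + cmod b ^ 2 = 1"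
  shows "sq_norm (lin2 (cnj a) (cnj b) (- b) a p) = sq_norm p"
proof -
  have 1: "a * cnj a + b * cnj b = 1"
    using arg_cong[OF assms, of complex_of_real] by (simp add: complex_norm_square del: of_real_power)
  have "complex_of_real (sq_norm (lin2 (cnj a) (cnj b) (- b) a p)) =
     (a * cnj a + b * cnj b) * complex_of_real (sq_norm p)"
    by (simp add: sq_norm_eq_complex lin2_def algebra_simps)
  then show ?thesis unfolding 1 by (simp only: mult_1 of_real_eq_iff)
qed

lemma lborel_distr_unitary:
  assumes "cmod a ^ 2 + cmod b ^ 2 = 1"
  shows "distr lborel borel (lin2 (cnj a) (cnj b) (- b) a) = lborel"
proof (rule lborel_distr_lin2)
  show "cnj a * a - cnj b * - b = 1"
    using arg_cong[OF assms, of complex_of_real]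
    by (simp add: complex_norm_square mult.commute del: of_real_power)
qed

text \<open>Integral over the second row \<open>q\<close> for a fixed first row \<open>p\<close>.
  The rotation adapted to \<open>p\<close> preserves Lebesgue measure and \<open>sq_norm q\<close>,
  and reduces the determinant to a single entry.\<close>

lemma nn_integral_gaussian_det_pair:
  "(\<integral>\<^sup>+q. ennreal (sq_norm q ^ s * cmod (fst p * snd q - snd p * fst q) ^ (2 * j) * exp (- sq_norm q)) \<partial>lborel)
   = ennreal (sq_norm p ^ j) * ennreal (pi\<^sup>2 * (fact s * fact j * real ((s + j + 1) choose (j + 1))))"
proof (cases "sq_norm p = 0")
  \<comment> \<open>A zero row has no direction to rotate to. Both sides are then 0 unless
    \<open>j = 0\<close>, where the determinant factor is 1.\<close>
  case True
  then have "fst p = 0" "snd p = 0" by (simp_all add: sq_norm_def add_nonneg_eq_0_iff)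
  then show ?thesis using True nn_integral_gaussian_pair_moment[of s 0] by (cases "j = 0") (auto simp: zero_power)
next
  case False
  then obtain a b where ab: "cmod a ^ 2 + cmod b ^ 2 = 1"
    "\<And>q. cmod (fst p * snd q - snd p * fst q) ^ 2 = sq_norm p * cmod (snd (lin2 (cnj a) (cnj b) (- b) a q)) ^ 2"
    by (rule cmod_rotate_det) blast
  let ?U = "lin2 (cnj a) (cnj b) (- b) a"
  let ?f = "\<lambda>q. ennreal (sq_norm q ^ s * cmod (snd q) ^ (2 * j) * exp (- sq_norm q))"
  have [measurable]: "?f \<in> borel_measurable borel" by measurable
  have "(\<integral>\<^sup>+q. ennreal (sq_norm q ^ s * cmod (fst p * snd q - snd p * fst q) ^ (2 * j) * exp (- sq_norm q)) \<partial>lborel)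
     = (\<integral>\<^sup>+q. ennreal (sq_norm p ^ j) * ?f (?U q) \<partial>lborel)"
    unfolding power_mult ab(2) sq_norm_lin2[OF ab(1)]
    by (intro nn_integral_cong) (simp add: power_mult_distrib mult_ac flip: ennreal_mult)
  also have "\<dots> = ennreal (sq_norm p ^ j) * (\<integral>\<^sup>+q. ?f (?U q) \<partial>lborel)"
    by (rule nn_integral_cmult) measurable
  also have "(\<integral>\<^sup>+q. ?f (?U q) \<partial>lborel) = (\<integral>\<^sup>+q. ?f q \<partial>distr lborel borel ?U)"
    by (subst nn_integral_distr) simp_all
  finally show ?thesis
    by (simp only: lborel_distr_unitary[OF ab(1)] nn_integral_gaussian_pair_moment)
qed

section \<open>Moments of the Gaussian measure on matrices\<close>

lemma trace_adjoint_mult_mat2: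
  fixes H :: "complex^2^2"
  shows
  "trace (adjoint_mat H ** H) = complex_of_real
     ((cmod (H$1$1))\<^sup>2 + (cmod (H$1$2))\<^sup>2 + (cmod (H$2$1))\<^sup>2 + (cmod (H$2$2))\<^sup>2)"
  by (simp add: trace_def sum_2 matrix_matrix_mult_def adjoint_mat_def complex_norm_square mult.commute
    del: of_real_power)

lemma borel_measurable_mat_nth [measurable]:
  "(\<lambda>H::complex^2^2. H $ i $ j) \<in> borel_measurable borel"
  by (intro borel_measurable_continuous_onI continuous_intros)

lemma borel_measurable_gauss_density:
  "(\<lambda>H::complex^2^2. ennreal (pi powr (-4) * exp (- Re (trace (adjoint_mat H ** H))))) \<in> borel_measurable borel"
  unfolding trace_adjoint_mult_mat2 by measurable

lemma sets_gauss_M2 [measurable_cong, simp]: "sets gauss_M2 = sets borel"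
  and space_gauss_M2 [simp]: "space gauss_M2 = UNIV"
  by (simp_all add: gauss_M2_def)

lemma borel_measurable_det2 [measurable]: "(\<lambda>H::complex^2^2. det H) \<in> borel_measurable borel"
  unfolding det_2 by measurable

definition row_norm :: "2 \<Rightarrow> complex^2^2 \<Rightarrow> real" where
  "row_norm i H = sq_norm (H $ i $ 1, H $ i $ 2)"

lemma borel_measurable_row_norm [measurable]: "row_norm i \<in> borel_measurable borel"
  unfolding row_norm_def sq_norm_def by simp

lemma row_norm_nonneg [simp]: "row_norm i H \<ge> 0"
  by (simp add: row_norm_def)

text \<open>The density factors over the rows. Integrating out the second row leaves
  \<open>sq_norm x ^ j\<close> times a constant, hence a pure norm moment of order
  \<open>p + j\<close> for the first; each row yields \<open>pi\<^sup>2\<close>, cancelling the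
  normalization.\<close>

lemma nn_integral_gauss_M2_moment:
  "(\<integral>\<^sup>+H. ennreal (row_norm 1 H ^ p * row_norm 2 H ^ s * cmod (det H) ^ (2 * j)) \<partial>gauss_M2)
   = ennreal (fact p * fact s * fact j * fact (j + 1) *
       real ((p + j + 1) choose (j + 1)) * real ((s + j + 1) choose (j + 1)))"
proof -
  define K where "K = pi\<^sup>2 * (fact s * fact j * real ((s + j + 1) choose (j + 1)))"
  let ?F = "\<lambda>x y. sq_norm x ^ p * exp (- sq_norm x) *
     (sq_norm y ^ s * cmod (fst x * snd y - snd x * fst y) ^ (2 * j) * exp (- sq_norm y))"
  let ?G = "\<lambda>H. ennreal (pi powr (-4) * exp (- Re (trace (adjoint_mat H ** H)))) *
     ennreal (row_norm 1 H ^ p * row_norm 2 H ^ s * cmod (det H) ^ (2 * j))"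
  have F: "(\<lambda>q. ennreal (?F (fst q) (snd q))) \<in> borel_measurable borel"
    unfolding sq_norm_def
    by (intro measurable_compose[OF _ measurable_ennreal] borel_measurable_continuous_onI continuous_intros)
  have M: "(\<lambda>H::complex^2^2. ennreal (row_norm 1 H ^ p * row_norm 2 H ^ s * cmod (det H) ^ (2 * j))) \<in> borel_measurable borel"
    by measurable
  have pi4: "pi powr (-4) = 1 / pi ^ 4" by (rule powr_neg_numeral) simp
  have "(\<integral>\<^sup>+H. ennreal (row_norm 1 H ^ p * row_norm 2 H ^ s * cmod (det H) ^ (2 * j)) \<partial>gauss_M2)
    = (\<integral>\<^sup>+H. ?G H \<partial>distr lborel borel of_rows)"
    unfolding gauss_M2_def lborel_distr_of_rows 
  proof (rule nn_integral_density)
    show "(\<lambda>H::complex^2^2. ennreal (row_norm 1 H ^ p * row_norm 2 H ^ s * cmod (det H) ^ (2 * j))) \<in> borel_measurable lborel"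
      using M by simp
  qed (simp only: measurable_lborel2 borel_measurable_gauss_density)
  also have "\<dots> = (\<integral>\<^sup>+q. ?G (of_rows q) \<partial>lborel)"
    by (rule nn_integral_distr)
      (simp_all only: measurable_lborel2 measurable_distr_eq1 borel_measurable_of_rows M borel_measurable_gauss_density borel_measurable_times_ennreal)
  also have "\<dots> = (\<integral>\<^sup>+q. ennreal (1 / pi ^ 4) * ennreal (?F (fst q) (snd q)) \<partial>lborel)"
    unfolding pi4
    by (intro nn_integral_cong)
      (simp add: trace_adjoint_mult_mat2 row_norm_def det_2 sq_norm_def exp_add[symmetric] mult_ac add_ac
        flip: ennreal_mult)
  also have "\<dots> = ennreal (1 / pi ^ 4) * (\<integral>\<^sup>+q. ennreal (?F (fst q) (snd q)) \<partial>lborel)"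
    by (rule nn_integral_cmult) (simp only: measurable_lborel2 F)
  also have "(\<integral>\<^sup>+q. ennreal (?F (fst q) (snd q)) \<partial>lborel) = (\<integral>\<^sup>+x. \<integral>\<^sup>+y. ennreal (?F x y) \<partial>lborel \<partial>lborel)"
    by (subst nn_integral_lborel_Pair(1)[OF F]) simp
  \<comment> \<open>The trivial factor with exponent \<open>2 * 0\<close> brings the integrand into
    the shape of the pair moment with second index 0.\<close>
  also have "\<dots> = (\<integral>\<^sup>+x. ennreal (sq_norm x ^ (p + j) * cmod (snd x) ^ (2 * 0) * exp (- sq_norm x)) * ennreal K \<partial>lborel)"
  proof (intro nn_integral_cong)
    fix x
    have "(\<integral>\<^sup>+y. ennreal (?F x y) \<partial>lborel) = ennreal (sq_norm x ^ p * exp (- sq_norm x)) *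
       (\<integral>\<^sup>+y. ennreal (sq_norm y ^ s * cmod (fst x * snd y - snd x * fst y) ^ (2 * j) * exp (- sq_norm y)) \<partial>lborel)"
    proof (subst nn_integral_cmult[symmetric])
      show "(\<lambda>y. ennreal (sq_norm y ^ s * cmod (fst x * snd y - snd x * fst y) ^ (2 * j) * exp (- sq_norm y)))
          \<in> borel_measurable lborel"
        unfolding sq_norm_def measurable_lborel2
        by (intro measurable_compose[OF _ measurable_ennreal] borel_measurable_continuous_onI continuous_intros)
    qed (simp add: ennreal_mult)
    also have "\<dots> = ennreal (sq_norm x ^ (p + j) * cmod (snd x) ^ (2 * 0) * exp (- sq_norm x)) * ennreal K"
      unfolding nn_integral_gaussian_det_pair K_def[symmetric]
      by (simp add: power_add mult_ac ennreal_mult)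
    finally show "(\<integral>\<^sup>+y. ennreal (?F x y) \<partial>lborel) = \<dots>" .
  qed
  also have "\<dots> = ennreal (pi\<^sup>2 * (fact (p + j) * fact 0 * real ((p + j + 0 + 1) choose (0 + 1)))) * ennreal K"
    by (subst nn_integral_multc) (simp_all only: nn_integral_gaussian_pair_moment, simp)
  also have "ennreal (1 / pi ^ 4) * \<dots> = ennreal (1 / pi ^ 4 * (pi\<^sup>2 * (fact (p + j + 1)) * K))"
    by (simp add: K_def ennreal_mult[symmetric] algebra_simps)
  also have "1 / pi ^ 4 * (pi\<^sup>2 * (fact (p + j + 1)) * K) =
     fact p * fact s * fact j * fact (j + 1) * real ((p + j + 1) choose (j + 1)) * real ((s + j + 1) choose (j + 1))"
  proof -
    \<comment> \<open>Rewriting (p+j+1)! through a binomial coefficient makes the result symmetric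
      in \<open>p\<close> and \<open>s\<close>.\<close>
    have "real ((p + j + 1) choose (j + 1)) = fact (p + j + 1) / (fact (j + 1) * fact p)"
      using binomial_fact[of "j + 1" "p + j + 1", where 'a=real] by (simp del: fact_Suc binomial_Suc_Suc)
    then have "fact (p + j + 1) = fact p * fact (j + 1) * real ((p + j + 1) choose (j + 1))"
      by (simp del: fact_Suc binomial_Suc_Suc)
    then show ?thesis
      unfolding K_def by (simp only:) (simp add: power4_eq_xxxx power2_eq_square)
  qed
  finally show ?thesis .
qed

subsection \<open>Unitary invariance and diagonalization\<close>

text \<open>For \<open>(a, b)\<close> of norm one this is the SU(2) matrix U whose adjoint has first
  column \<open>(a, b)\<close>, later an eigenvector for \<open>d1\<close>.\<close>

definition mat_lin2 :: "complex \<Rightarrow> complex \<Rightarrow> complex^2^2" where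
  "mat_lin2 a b = of_rows ((cnj a, cnj b), (- b, a))"

lemma mat_lin2_mult_of_columns:
  "mat_lin2 a b ** of_columns q =
     of_columns (map_prod (lin2 (cnj a) (cnj b) (- b) a) (lin2 (cnj a) (cnj b) (- b) a) q)"
  by (simp add: mat2_eq_iff matrix_matrix_mult_def sum_2 mat_lin2_def lin2_def)

lemma det_mat_lin2:
  assumes "cmod a ^ 2 + cmod b ^ 2 = 1"
  shows "det (mat_lin2 a b) = 1"
  using arg_cong[OF assms, of complex_of_real]
  by (simp add: det_2 mat_lin2_def complex_norm_square mult.commute del: of_real_power)

lemma borel_measurable_matrix_mult_left [measurable]:
  fixes V :: "complex^2^2"
  shows "(\<lambda>H::complex^2^2. V ** H) \<in> borel_measurable borel"
  unfolding matrix_matrix_mult_def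
  by (intro borel_measurable_continuous_onI continuous_on_vec_lambda continuous_intros)

lemma lborel_distr_map_prod:
  fixes f :: "'a::euclidean_space \<Rightarrow> 'a" and g :: "'b::euclidean_space \<Rightarrow> 'b"
  assumes [measurable]: "f \<in> borel_measurable borel" "g \<in> borel_measurable borel"
    and f: "distr lborel borel f = lborel" and g: "distr lborel borel g = lborel"
  shows "distr lborel borel (map_prod f g) = lborel"
proof -
  have "(lborel :: ('a \<times> 'b) measure) = distr lborel borel f \<Otimes>\<^sub>M distr lborel borel g"
    unfolding f g lborel_prod ..
  also have "\<dots> = distr (lborel \<Otimes>\<^sub>M lborel) (borel \<Otimes>\<^sub>M borel) (\<lambda>(x, y). (f x, g y))"
    by (rule pair_measure_distr) (simp_all add: g lborel.sigma_finite_measure_axioms)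
  also have "\<dots> = distr lborel borel (map_prod f g)"
    unfolding lborel_prod borel_prod by (simp add: map_prod_def)
  finally show ?thesis ..
qed

lemma lborel_distr_mat_lin2:
  assumes "cmod a ^ 2 + cmod b ^ 2 = 1"
  shows "distr lborel borel (\<lambda>H::complex^2^2. mat_lin2 a b ** H) = lborel"
proof -
  let ?U = "lin2 (cnj a) (cnj b) (- b) a"
  have U: "distr lborel borel (map_prod ?U ?U) = lborel"
    by (intro lborel_distr_map_prod borel_measurable_lin2 lborel_distr_unitary assms)
  have [measurable]: "map_prod ?U ?U \<in> borel_measurable borel"
    unfolding map_prod_def lin2_def case_prod_unfold
    by (intro borel_measurable_continuous_onI continuous_intros)
  have "distr lborel borel (\<lambda>H::complex^2^2. mat_lin2 a b ** H)
      = distr (distr lborel borel of_columns) borel (\<lambda>H. mat_lin2 a b ** H)"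
    by (simp only: lborel_distr_of_columns)
  also have "\<dots> = distr lborel borel (of_columns \<circ> map_prod ?U ?U)"
    by (subst distr_distr) (simp_all add: comp_def mat_lin2_mult_of_columns)
  also have "\<dots> = distr (distr lborel borel (map_prod ?U ?U)) borel of_columns"
    by (rule distr_distr[symmetric]) simp_all
  finally show ?thesis by (simp only: U lborel_distr_of_columns)
qed

lemma trace_adjoint_mult_mat_lin2:
  assumes "cmod a ^ 2 + cmod b ^ 2 = 1"
  shows "trace (adjoint_mat (mat_lin2 a b ** H) ** (mat_lin2 a b ** H)) = trace (adjoint_mat H ** H)"
proof -
  have *: "trace (adjoint_mat H ** H) =
    complex_of_real (sq_norm (H$1$1, H$2$1) + sq_norm (H$1$2, H$2$2))" for H :: "complex^2^2"
    by (simp add: trace_adjoint_mult_mat2 sq_norm_def)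
  have "((mat_lin2 a b ** H)$1$k, (mat_lin2 a b ** H)$2$k) = lin2 (cnj a) (cnj b) (- b) a (H$1$k, H$2$k)" for k
    by (simp add: matrix_matrix_mult_def sum_2 mat_lin2_def lin2_def)
  then show ?thesis unfolding * by (simp only: sq_norm_lin2[OF assms])
qed

text \<open>Lebesgue measure is invariant column by column, and the density depends only on the
  column norms, which a unitary preserves.\<close>

lemma gauss_M2_distr_mat_lin2:
  assumes "cmod a ^ 2 + cmod b ^ 2 = 1"
  shows "distr gauss_M2 borel (\<lambda>H. mat_lin2 a b ** H) = gauss_M2"
proof -
  let ?w = "\<lambda>H::complex^2^2. ennreal (pi powr (-4) * exp (- Re (trace (adjoint_mat H ** H))))"
  let ?T = "\<lambda>H. mat_lin2 a b ** H"
  have "gauss_M2 = density (distr lborel borel ?T) ?w"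
    by (simp only: gauss_M2_def lborel_distr_mat_lin2[OF assms])
  also have "\<dots> = distr (density lborel (\<lambda>H. ?w (?T H))) borel ?T"
    by (rule density_distr) (simp_all only: borel_measurable_gauss_density borel_measurable_matrix_mult_left measurable_lborel2)
  finally show ?thesis
    by (simp only: trace_adjoint_mult_mat_lin2[OF assms] gauss_M2_def)
qed

section \<open>Unitary diagonalization of a Hermitian 2x2 matrix\<close>

text \<open>The four entry equations say that A is the adjoint of U times diag(d1, d2) times U, for
  U = \<open>mat_lin2 a b\<close>.\<close>

lemma hermitian_mat2_diagonalization:
  fixes A :: "complex^2^2"
  assumes herm: "hermitian_mat A"
    and eig: "\<forall>x. charpoly_at A x = (x - complex_of_real d1) * (x - complex_of_real d2)"
  obtains a b where "cmod a ^ 2 + cmod b ^ 2 = 1"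
    "A$1$1 = d1 * (a * cnj a) + d2 * (b * cnj b)"
    "A$2$2 = d1 * (b * cnj b) + d2 * (a * cnj a)"
    "A$1$2 = complex_of_real (d1 - d2) * (a * cnj b)"
    "A$2$1 = complex_of_real (d1 - d2) * (cnj a * b)"
    "det A = complex_of_real (d1 * d2)"
proof -
  have h: "cnj (A$1$1) = A$1$1" "cnj (A$2$2) = A$2$2" "A$2$1 = cnj (A$1$2)"
    using herm by (simp_all add: hermitian_mat_def adjoint_mat_def vec_eq_iff forall_2)
  define p q r where "p = Re (A$1$1)" and "q = A$1$2" and "r = Re (A$2$2)"
  have A: "A$1$1 = of_real p" "A$2$2 = of_real r" "A$1$2 = q" "A$2$1 = cnj q"
    using h by (simp_all add: p_def q_def r_def complex_eq_iff)
  have c: "(x - of_real p) * (x - of_real r) - q * cnj q = (x - of_real d1) * (x - of_real d2)" for x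
    using eig[rule_format, of x] by (simp add: charpoly_at_def det_2 A mat_def)
  \<comment> \<open>The characteristic polynomial at 0 gives the determinant, and at 1 then the
    trace.\<close>
  have detc: "complex_of_real p * of_real r - q * cnj q = of_real d1 * of_real d2"
    using c[of 0] by simp
  have trc: "complex_of_real (p + r) = of_real (d1 + d2)"
    using c[of 1] detc by (simp add: algebra_simps)
  then have tr: "p + r = d1 + d2" by (simp only: of_real_eq_iff)
  have "complex_of_real (p * r - (cmod q)\<^sup>2) = of_real (d1 * d2)"
    using detc by (simp add: complex_norm_square del: of_real_power)
  then have dt: "p * r - (cmod q)\<^sup>2 = d1 * d2" by (simp only: of_real_eq_iff)
  have r: "r = d1 + d2 - p" using tr by simp
  have dt': "(cmod q)\<^sup>2 = (d1 - p) * (p - d2)" using dt unfolding r by (simp add: algebra_simps)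
  have detA: "det A = complex_of_real (d1 * d2)" using detc by (simp add: det_2 A)
  show ?thesis
  proof (cases "q = 0")
    case True
    \<comment> \<open>A is already diagonal; U is the identity or exchanges the two coordinates up
      to sign.\<close>
    then have "p = d1 \<or> p = d2" using dt' by auto
    then show ?thesis
    proof
      assume "p = d1"
      then show ?thesis using that[of 1 0] True detA r by (simp add: A)
    next
      assume "p = d2"
      then show ?thesis using that[of 0 1] True detA r by (simp add: A)
    qed
  next
    case False
    \<comment> \<open>The vector \<open>(q, d1 - p)\<close> is an eigenvector for \<open>d1\<close>,
      and \<open>N\<close> is its squared length, rewritten with the determinant relation.\<close>
    define N where "N = (d1 - p) * (d1 - d2)"
    have N: "N = (cmod q)\<^sup>2 + (d1 - p)\<^sup>2"
      unfolding dt' N_def by (simp add: power2_eq_square algebra_simps)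
    have Npos: "N > 0" unfolding N using False by (simp add: add_pos_nonneg)
    define s where "s = sqrt N"
    have s: "s > 0" "s\<^sup>2 = N" using Npos by (simp_all add: s_def)
    let ?a = "q / of_real s" and ?b = "of_real ((d1 - p) / s) :: complex"
    have aa: "?a * cnj ?a = of_real ((cmod q)\<^sup>2 / N)"
      using s by (simp add: power2_eq_square complex_norm_square[symmetric] del: of_real_power flip: of_real_mult s(2))
    have bb: "?b * cnj ?b = of_real ((d1 - p)\<^sup>2 / N)"
      using s by (simp add: power2_eq_square flip: s(2))
    have ab: "?a * cnj ?b = q * of_real ((d1 - p) / N)" "cnj ?a * ?b = cnj q * of_real ((d1 - p) / N)"
      using s by (simp_all add: power2_eq_square flip: s(2))
    have f: "(d1 - d2) * ((d1 - p) / N) = 1"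
    proof -
      have "d1 - p \<noteq> 0" "d1 - d2 \<noteq> 0" using Npos by (auto simp: N_def)
      then show ?thesis by (simp add: N_def)
    qed
    show ?thesis
    proof (rule that[of ?a ?b])
      show "(cmod ?a)\<^sup>2 + (cmod ?b)\<^sup>2 = 1"
      proof -
        have "(cmod ?a)\<^sup>2 = (cmod q)\<^sup>2 / N" using s by (simp add: norm_divide power_divide)
        moreover have "(cmod ?b)\<^sup>2 = (d1 - p)\<^sup>2 / N"
          by (simp only: norm_of_real power2_abs power_divide s(2))
        ultimately show ?thesis using Npos by (simp add: N[symmetric] flip: add_divide_distrib)
      qed
      have "p = d1 * ((cmod q)\<^sup>2 / N) + d2 * ((d1 - p)\<^sup>2 / N)"
        using Npos by (simp add: field_simps dt') (simp add: N_def power2_eq_square algebra_simps)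
      then show "A$1$1 = d1 * (?a * cnj ?a) + d2 * (?b * cnj ?b)"
        unfolding aa bb A of_real_mult[symmetric] of_real_add[symmetric] of_real_eq_iff .
      have "r = d1 * ((d1 - p)\<^sup>2 / N) + d2 * ((cmod q)\<^sup>2 / N)"
        using Npos unfolding r by (simp add: field_simps dt') (simp add: N_def power2_eq_square algebra_simps)
      then show "A$2$2 = d1 * (?b * cnj ?b) + d2 * (?a * cnj ?a)"
        unfolding aa bb A of_real_mult[symmetric] of_real_add[symmetric] of_real_eq_iff .
      have fc: "complex_of_real (d1 - d2) * (z * of_real ((d1 - p) / N)) = z" for z
        using f by (metis mult.left_commute mult.right_neutral of_real_1 of_real_mult)
      show "A$1$2 = complex_of_real (d1 - d2) * (?a * cnj ?b)" "A$2$1 = complex_of_real (d1 - d2) * (cnj ?a * ?b)"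
        unfolding ab fc A by simp_all
    qed (use detA in simp)
  qed
qed

text \<open>With K = U H the matrix is the adjoint of K times diag(d1, d2) times K, so its trace
  weights the squared row norms of K. For the determinant, multiplicativity and det U = 1
  suffice.\<close>

lemma adjoint_conjugation_invariants:
  fixes A H :: "complex^2^2"
  assumes ab: "cmod a ^ 2 + cmod b ^ 2 = 1"
    and A: "A$1$1 = d1 * (a * cnj a) + d2 * (b * cnj b)"
    "A$2$2 = d1 * (b * cnj b) + d2 * (a * cnj a)"
    "A$1$2 = complex_of_real (d1 - d2) * (a * cnj b)"
    "A$2$1 = complex_of_real (d1 - d2) * (cnj a * b)"
    "det A = complex_of_real (d1 * d2)"
  defines "K \<equiv> mat_lin2 a b ** H"
  shows "trace (adjoint_mat H ** A ** H) = complex_of_real (d1 * row_norm 1 K + d2 * row_norm 2 K)"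
    and "det (adjoint_mat H ** A ** H) = complex_of_real (d1 * d2 * cmod (det K) ^ 2)"
proof -
  have "complex_of_real (d1 * row_norm 1 K + d2 * row_norm 2 K) =
    d1 * (K$1$1 * cnj (K$1$1) + K$1$2 * cnj (K$1$2)) + d2 * (K$2$1 * cnj (K$2$1) + K$2$2 * cnj (K$2$2))"
    by (simp add: row_norm_def sq_norm_eq_complex)
  also have "\<dots> = trace (adjoint_mat H ** A ** H)"
    by (simp add: trace_def sum_2 matrix_matrix_mult_def adjoint_mat_def A K_def mat_lin2_def algebra_simps)
  finally show "trace (adjoint_mat H ** A ** H) = complex_of_real (d1 * row_norm 1 K + d2 * row_norm 2 K)" ..
  have "det (adjoint_mat H) = cnj (det H)"
    by (simp add: det_2 adjoint_mat_def)
  moreover have "det K = det H" by (simp add: K_def det_mul det_mat_lin2[OF ab])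
  ultimately show "det (adjoint_mat H ** A ** H) = complex_of_real (d1 * d2 * cmod (det K) ^ 2)"
    by (simp add: det_mul A(5) complex_norm_square del: of_real_power)
qed

subsection \<open>The expected trace\<close>

text \<open>Waring's formula with trace and determinant of the diagonal case inserted; for
  \<open>m \<ge> 1\<close> it is the real value of the traced power when A = diag(d1, d2).\<close>

definition wishart_power_trace :: "real \<Rightarrow> real \<Rightarrow> nat \<Rightarrow> complex^2^2 \<Rightarrow> real" where
  "wishart_power_trace d1 d2 m H =
     (\<Sum>j\<le>m. (-1) ^ j * power_sum_coeff m j *
        (d1 * row_norm 1 H + d2 * row_norm 2 H) ^ (m - 2 * j) * (d1 * d2 * (cmod (det H))\<^sup>2) ^ j)"

lemma borel_measurable_wishart_power_trace [measurable]:
  "wishart_power_trace d1 d2 m \<in> borel_measurable borel"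
  unfolding wishart_power_trace_def by measurable

lemma has_bochner_integral_gauss_M2_moment:
  "has_bochner_integral gauss_M2 (\<lambda>H. row_norm 1 H ^ p * row_norm 2 H ^ s * cmod (det H) ^ (2 * j))
     (fact p * fact s * fact j * fact (j + 1) *
       real ((p + j + 1) choose (j + 1)) * real ((s + j + 1) choose (j + 1)))"
proof (rule has_bochner_integral_nn_integral[OF _ _ _ nn_integral_gauss_M2_moment])
  show "(\<lambda>H. row_norm 1 H ^ p * row_norm 2 H ^ s * cmod (det H) ^ (2 * j)) \<in> borel_measurable gauss_M2"
    by measurable
qed (simp_all del: fact_Suc)

lemma has_bochner_integral_mixed_moment:
  "has_bochner_integral gauss_M2
     (\<lambda>H. (d1 * row_norm 1 H + d2 * row_norm 2 H) ^ n * (d1 * d2 * (cmod (det H))\<^sup>2) ^ j)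
     (fact n * fact j * fact (Suc j) *
       (\<Sum>p\<le>n. real (p + j + 1 choose (j + 1)) * real (n - p + j + 1 choose (j + 1)) *
             (d1 * d2) ^ j * d1 ^ p * d2 ^ (n - p)))"
proof -
  let ?c = "\<lambda>p. real (n choose p) * d1 ^ p * d2 ^ (n - p) * (d1 * d2) ^ j"
  let ?I = "\<lambda>p. fact p * fact (n - p) * fact j * fact (j + 1) *
     real ((p + j + 1) choose (j + 1)) * real ((n - p + j + 1) choose (j + 1))"
  have "has_bochner_integral gauss_M2
     (\<lambda>H. \<Sum>p\<le>n. ?c p * (row_norm 1 H ^ p * row_norm 2 H ^ (n - p) * cmod (det H) ^ (2 * j)))
     (\<Sum>p\<le>n. ?c p * ?I p)"
    by (intro has_bochner_integral_sum has_bochner_integral_mult_right has_bochner_integral_gauss_M2_moment)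
  moreover have "(\<lambda>H. \<Sum>p\<le>n. ?c p * (row_norm 1 H ^ p * row_norm 2 H ^ (n - p) * cmod (det H) ^ (2 * j)))
     = (\<lambda>H. (d1 * row_norm 1 H + d2 * row_norm 2 H) ^ n * (d1 * d2 * (cmod (det H))\<^sup>2) ^ j)"
    unfolding power_mult
    by (intro ext) (simp add: binomial_ring sum_distrib_left sum_distrib_right power_mult_distrib mult_ac)
  moreover have "(\<Sum>p\<le>n. ?c p * ?I p) = fact n * fact j * fact (Suc j) *
       (\<Sum>p\<le>n. real (p + j + 1 choose (j + 1)) * real (n - p + j + 1 choose (j + 1)) *
             (d1 * d2) ^ j * d1 ^ p * d2 ^ (n - p))"
    unfolding sum_distrib_left
  proof (intro sum.cong refl)
    fix p assume "p \<in> {..n}"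
    \<comment> \<open>The binomial weight from expanding the power absorbs the factorials
      \<open>fact p * fact (n - p)\<close> of the moment, so only \<open>fact n\<close> remains
      outside the sum.\<close>
    then have b: "fact n = real (n choose p) * fact p * fact (n - p)"
      by (simp add: binomial_fact)
    show "?c p * ?I p = fact n * fact j * fact (Suc j) *
       (real (p + j + 1 choose (j + 1)) * real (n - p + j + 1 choose (j + 1)) *
             (d1 * d2) ^ j * d1 ^ p * d2 ^ (n - p))"
      unfolding b by (simp only: mult_ac Suc_eq_plus1)
  qed
  ultimately show ?thesis by simp
qed

text \<open>Integrate Waring's formula termwise, then exchange the sums over \<open>j\<close> and
  \<open>k\<close>, so that the alternating sum over \<open>j\<close> is evaluated for each
  monomial.\<close>

lemma has_bochner_integral_wishart_power_trace:
  assumes m: "m \<ge> 1"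
  shows "has_bochner_integral gauss_M2 (wishart_power_trace d1 d2 m)
    (fact m * (real m * (\<Sum>k\<le>m. d1 ^ k * d2 ^ (m - k)) + d1 ^ m + d2 ^ m))"
proof -
  let ?B = "\<lambda>j k. real (Suc k choose Suc j) * real (Suc (m - k) choose Suc j) * d1 ^ k * d2 ^ (m - k)"
  let ?c = "\<lambda>j. (-1) ^ j * power_sum_coeff m j * fact (m - 2 * j) * fact j * fact (Suc j)"
  have "has_bochner_integral gauss_M2
     (\<lambda>H. (-1) ^ j * power_sum_coeff m j *
        ((d1 * row_norm 1 H + d2 * row_norm 2 H) ^ (m - 2 * j) * (d1 * d2 * (cmod (det H))\<^sup>2) ^ j))
     (?c j * (\<Sum>k\<le>m. ?B j k))" for j
  \<comment> \<open>For \<open>2 * j > m\<close> the exponent \<open>m - 2 * j\<close> is truncated,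
    but the coefficient is 0.\<close>
  proof (cases "2 * j \<le> m")
    case True
    show ?thesis
      using has_bochner_integral_mult_right[OF has_bochner_integral_mixed_moment[of d1 d2 "m - 2 * j" j],
          of "(-1) ^ j * power_sum_coeff m j"]
      unfolding binomial_convolution_shift[OF True] by (simp only: mult.assoc)
  qed (simp add: power_sum_coeff_def has_bochner_integral_zero)
  then have "has_bochner_integral gauss_M2
     (\<lambda>H. \<Sum>j\<le>m. (-1) ^ j * power_sum_coeff m j *
        ((d1 * row_norm 1 H + d2 * row_norm 2 H) ^ (m - 2 * j) * (d1 * d2 * (cmod (det H))\<^sup>2) ^ j))
     (\<Sum>j\<le>m. ?c j * (\<Sum>k\<le>m. ?B j k))"
    by (intro has_bochner_integral_sum)
  moreover have "(\<Sum>j\<le>m. ?c j * (\<Sum>k\<le>m. ?B j k)) =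
      fact m * (real m * (\<Sum>k\<le>m. d1 ^ k * d2 ^ (m - k)) + d1 ^ m + d2 ^ m)"
  proof -
    have "(\<Sum>j\<le>m. ?c j * (\<Sum>k\<le>m. ?B j k)) = (\<Sum>k\<le>m. \<Sum>j\<le>m. ?c j * ?B j k)"
      unfolding sum_distrib_left by (rule sum.swap)
    also have "\<dots> = (\<Sum>k\<le>m. (\<Sum>j\<le>m. ?c j * real (Suc k choose Suc j) * real (Suc (m - k) choose Suc j)) *
         (d1 ^ k * d2 ^ (m - k)))"
      unfolding sum_distrib_right by (simp only: mult.assoc)
    also have "\<dots> = (\<Sum>k\<le>m. fact m * (real m + of_bool (k = 0) + of_bool (k = m)) * (d1 ^ k * d2 ^ (m - k)))"
      by (intro sum.cong refl) (simp only: power_sum_coeff_binomial_sum[OF m] atMost_iff)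
    \<comment> \<open>The two indicators only affect the end monomials, \<open>d2 ^ m\<close> at k =
      0 and \<open>d1 ^ m\<close> at k = m.\<close>
    also have "\<dots> = (\<Sum>k\<le>m. fact m * (real m * (d1 ^ k * d2 ^ (m - k)) +
        (if k = 0 then d2 ^ m else 0) + (if k = m then d1 ^ m else 0)))"
      by (intro sum.cong refl) (auto simp: algebra_simps)
    also have "\<dots> = fact m * (real m * (\<Sum>k\<le>m. d1 ^ k * d2 ^ (m - k)) + d1 ^ m + d2 ^ m)"
      by (simp add: sum_distrib_left[symmetric] sum.distrib algebra_simps)
    finally show ?thesis .
  qed
  ultimately show ?thesis by (simp add: wishart_power_trace_def[abs_def] mult.assoc)
qed

text \<open>A division-free form covering distinct and equal eigenvalues at once. Pointwise the
  trace is \<open>wishart_power_trace\<close> at U H, and the Gaussian measure is invariant under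
  multiplication by U.\<close>

lemma integral_trace_matpow_gauss_M2:
  fixes A :: "complex^2^2" and d1 d2 :: real
  assumes herm: "hermitian_mat A"
    and eig: "\<forall>x. charpoly_at A x = (x - complex_of_real d1) * (x - complex_of_real d2)"
    and m: "m \<ge> 1"
  shows "integral\<^sup>L gauss_M2 (\<lambda>H. trace (matpow (adjoint_mat H ** A ** H) m)) =
    complex_of_real (fact m * (real m * (\<Sum>k\<le>m. d1 ^ k * d2 ^ (m - k)) + d1 ^ m + d2 ^ m))"
proof -
  obtain a b where ab: "cmod a ^ 2 + cmod b ^ 2 = 1"
    and A: "A$1$1 = d1 * (a * cnj a) + d2 * (b * cnj b)"
    "A$2$2 = d1 * (b * cnj b) + d2 * (a * cnj a)"
    "A$1$2 = complex_of_real (d1 - d2) * (a * cnj b)"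
    "A$2$1 = complex_of_real (d1 - d2) * (cnj a * b)"
    "det A = complex_of_real (d1 * d2)"
    by (rule hermitian_mat2_diagonalization[OF herm eig])
  have "trace (matpow (adjoint_mat H ** A ** H) m) =
      complex_of_real (wishart_power_trace d1 d2 m (mat_lin2 a b ** H))" for H :: "complex^2^2"
    unfolding trace_matpow_2[OF m] adjoint_conjugation_invariants[OF ab A] wishart_power_trace_def
    by simp
  then have "integral\<^sup>L gauss_M2 (\<lambda>H. trace (matpow (adjoint_mat H ** A ** H) m)) =
      complex_of_real (integral\<^sup>L gauss_M2 (\<lambda>H. wishart_power_trace d1 d2 m (mat_lin2 a b ** H)))"
    by simp
  also have "integral\<^sup>L gauss_M2 (\<lambda>H. wishart_power_trace d1 d2 m (mat_lin2 a b ** H)) =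
      integral\<^sup>L (distr gauss_M2 borel (\<lambda>H. mat_lin2 a b ** H)) (wishart_power_trace d1 d2 m)"
    by (rule integral_distr[symmetric]) measurable
  also have "\<dots> = fact m * (real m * (\<Sum>k\<le>m. d1 ^ k * d2 ^ (m - k)) + d1 ^ m + d2 ^ m)"
    unfolding gauss_M2_distr_mat_lin2[OF ab]
    by (rule has_bochner_integral_integral_eq[OF has_bochner_integral_wishart_power_trace[OF m]])
  finally show ?thesis .
qed

theorem theorem3:
  fixes A :: "complex^2^2" and d1 d2 :: real and m :: nat
  assumes herm: "hermitian_mat A"
    and eig: "\<forall>x. charpoly_at A x = (x - complex_of_real d1) * (x - complex_of_real d2)"
    and m: "m \<ge> 1"
  shows "(d1 \<noteq> d2 \<longrightarrow>
           integral\<^sup>L gauss_M2 (\<lambda>H. trace (matpow (adjoint_mat H ** A ** H) m)) =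
           complex_of_real (fact m * ((m + 1) * (d1 ^ (m + 1) - d2 ^ (m + 1)) / (d1 - d2)
                              + (d1 * d2 ^ m - d2 * d1 ^ m) / (d1 - d2))))
       \<and> (\<forall>d. d1 = d \<and> d2 = d \<longrightarrow>
           integral\<^sup>L gauss_M2 (\<lambda>H. trace (matpow (adjoint_mat H ** A ** H) m)) =
           complex_of_real (fact m * (real m ^ 2 + real m + 2) * d ^ m))"
proof (intro conjI allI impI)
  assume ne: "d1 \<noteq> d2"
  \<comment> \<open>\<open>S\<close> is the quotient of \<open>d1 ^ (m + 1) - d2 ^ (m + 1)\<close>
    by \<open>d1 - d2\<close>. The second quotient in the claim is
    \<open>d1 ^ m + d2 ^ m - S\<close>, which reduces \<open>(m + 1) * S\<close> to
    \<open>m * S\<close>.\<close>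
  define S where "S = (\<Sum>k\<le>m. d1 ^ k * d2 ^ (m - k))"
  have S: "d1 ^ (m + 1) - d2 ^ (m + 1) = (d1 - d2) * S"
    using power_diff_sumr2[of d1 "m + 1" d2] by (simp add: S_def lessThan_Suc_atMost mult_ac)
  have "(m + 1) * (d1 ^ (m + 1) - d2 ^ (m + 1)) / (d1 - d2) + (d1 * d2 ^ m - d2 * d1 ^ m) / (d1 - d2)
      = m * S + d1 ^ m + d2 ^ m"
  proof -
    have "d1 * d2 ^ m - d2 * d1 ^ m = (d1 - d2) * (d1 ^ m + d2 ^ m - S)"
      using S by (simp add: algebra_simps)
    then have "(d1 * d2 ^ m - d2 * d1 ^ m) / (d1 - d2) = d1 ^ m + d2 ^ m - S"
      using ne by simp
    moreover have "(m + 1) * (d1 ^ (m + 1) - d2 ^ (m + 1)) / (d1 - d2) = (m + 1) * S"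
      unfolding S using ne by simp
    ultimately show ?thesis by (simp only:) (simp add: algebra_simps)
  qed
  then show "integral\<^sup>L gauss_M2 (\<lambda>H. trace (matpow (adjoint_mat H ** A ** H) m)) =
           complex_of_real (fact m * ((m + 1) * (d1 ^ (m + 1) - d2 ^ (m + 1)) / (d1 - d2)
                              + (d1 * d2 ^ m - d2 * d1 ^ m) / (d1 - d2)))"
    unfolding integral_trace_matpow_gauss_M2[OF assms] S_def by (simp only:)
next
  fix d assume d: "d1 = d \<and> d2 = d"
  \<comment> \<open>All m + 1 terms equal \<open>d ^ m\<close>, giving the factor m(m+1) +
    2.\<close>
  have "(\<Sum>k\<le>m. d ^ k * d ^ (m - k)) = (\<Sum>k\<le>m. d ^ m)"
    by (intro sum.cong refl) (simp flip: power_add)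
  then have "fact m * (real m * (\<Sum>k\<le>m. d1 ^ k * d2 ^ (m - k)) + d1 ^ m + d2 ^ m) =
      fact m * (real m ^ 2 + real m + 2) * d ^ m"
    using d by (simp add: power2_eq_square algebra_simps)
  then show "integral\<^sup>L gauss_M2 (\<lambda>H. trace (matpow (adjoint_mat H ** A ** H) m)) =
           complex_of_real (fact m * (real m ^ 2 + real m + 2) * d ^ m)"
    unfolding integral_trace_matpow_gauss_M2[OF assms] by (simp only:)
qed

end
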